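(* Let $z_1,\dots,z_m\in\mathbb{R}^n$, $L=\operatorname{conv}\{z_1,\dots,z_m\}$, and for $c\in\mathbb{R}^n$ put $t_L(c)=\inf_{z\in L}\langle c,z\rangle$. Let $\hat c$ be a solution of the problem $\max_{\|c\|\le 1} t_L(c)$. Then: 1. If $t_L(\hat c)>0$ and $v=t_L(\hat c)\,\hat c$, then $\mathbf{P}_L(\mathbf{0})=v$. 2. If $t_L(\hat c)=0$, then $\mathbf{P}_L(\mathbf{0})=\mathbf{0}$.
   Context: Here $m\ge1$, $\langle\cdot,\cdot\rangle$ and $\|\cdot\|$ are the Euclidean inner product and norm on $\mathbb{R}^n$. $\mathbf{P}_L(\mathbf{0})$ denotes the projection of the origin onto $L$, i.e. the unique point of $L$ of minimal Euclidean norm. *)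

theory Defs
  imports "HOL-Analysis.Analysis"
begin

text \<open>
  The infimum is the conditionally complete one on \<^typ>\<open>real\<close>; it is the genuine infimum
  whenever \<open>L\<close> is nonempty and bounded, in particular for the convex hull of a nonempty finite set.
\<close>
definition t_inf :: "(real ^ 'n) set \<Rightarrow> real ^ 'n \<Rightarrow> real"
  where "t_inf L c = (INF z\<in>L. c \<bullet> z)"

end

theory Submission
  imports Defs
begin

text \<open>
  Let \<open>p\<close> be the point of \<open>L\<close> nearest to the origin. The number \<open>norm p\<close> is the optimal value of
  the problem of maximising \<^term>\<open>t_inf L\<close> over the unit ball. It is attained at
  \<^term>\<open>sgn p\<close>, because the variational inequality \<open>p \<bullet> p \<le> p \<bullet> z\<close> for \<open>z \<in> L\<close> says that
  \<open>L\<close> lies beyond the hyperplane through \<open>p\<close> orthogonal to \<open>p\<close>; and it is not exceeded, because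
  evaluating at the point \<open>p\<close> itself and applying Cauchy--Schwarz gives
  \<open>t_inf L c \<le> c \<bullet> p \<le> norm p\<close> on the unit ball.

  At a maximiser \<open>c\<close> these inequalities are therefore equalities, \<open>t_inf L c = c \<bullet> p = norm p\<close>,
  and equality in Cauchy--Schwarz forces \<open>p = norm p *\<^sub>R c\<close>, that is,
  \<open>p = t_inf L c *\<^sub>R c\<close>. This single identity yields both claims: when the optimal
  value is zero its right-hand side vanishes.
\<close>

lemma t_inf_le:
  assumes "compact L" "x \<in> L"
  shows "t_inf L c \<le> c \<bullet> x"
proof -
  have "compact ((\<lambda>x. c \<bullet> x) ` L)"
    using assms(1) by (intro compact_continuous_image continuous_intros)
  then have "bdd_below ((\<lambda>x. c \<bullet> x) ` L)"
    by (simp add: bounded_imp_bdd_below compact_imp_bounded)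
  then show ?thesis
    unfolding t_inf_def using assms(2) by (rule cINF_lower)
qed

text \<open>
  Using \<^const>\<open>sgn\<close> as the normalisation covers a nearest point at the origin as well: then
  \<open>sgn p = 0\<close> and the bound is \<open>0 \<le> 0\<close>.
\<close>

lemma norm_closest_point_le_t_inf_sgn:
  assumes "convex L" "closed L" "L \<noteq> {}"
  defines "p \<equiv> closest_point L 0"
  shows "norm p \<le> t_inf L (sgn p)"
proof -
  have "norm p \<le> sgn p \<bullet> x" if "x \<in> L" for x
  proof (cases "p = 0")
    case False
    have "p \<bullet> p \<le> p \<bullet> x"
      using closest_point_dot[OF assms(1,2) that, of 0]
      by (simp add: p_def inner_diff_right)
    then show ?thesis
      using False by (simp add: sgn_div_norm field_simps dot_square_norm power2_eq_square)
  qed simp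
  then show ?thesis
    unfolding t_inf_def using assms(3) by (intro cINF_greatest)
qed

text \<open>The equality case of Cauchy--Schwarz, for a second factor in the unit ball.\<close>

lemma eq_norm_scaleR_if_inner_eq_norm:
  fixes p c :: "'a::real_inner"
  assumes "norm c \<le> 1" "c \<bullet> p = norm p"
  shows "p = norm p *\<^sub>R c"
proof -
  have "(norm (p - norm p *\<^sub>R c))\<^sup>2
      = p \<bullet> p - 2 * norm p * (c \<bullet> p) + (norm p)\<^sup>2 * (c \<bullet> c)"
    unfolding power2_norm_eq_inner[of "p - norm p *\<^sub>R c"]
    by (simp add: inner_diff inner_commute[of p c] power2_eq_square algebra_simps)
  also have "\<dots> = (norm p)\<^sup>2 * (norm c)\<^sup>2 - (norm p)\<^sup>2"
    using assms(2) by (simp add: dot_square_norm power2_eq_square)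
  also have "\<dots> \<le> 0"
    using assms(1) by (simp add: mult_left_le power_le_one)
  finally show ?thesis by simp
qed

lemma closest_point_eq_t_inf_scaleR_maximiser:
  assumes "compact L" "convex L" "L \<noteq> {}"
    and max: "is_arg_max (t_inf L) (\<lambda>c. norm c \<le> 1) c"
  shows "closest_point L 0 = t_inf L c *\<^sub>R c"
proof -
  define p where "p = closest_point L 0"
  have "closed L"
    using assms(1) by (rule compact_imp_closed)
  have "p \<in> L"
    unfolding p_def using \<open>closed L\<close> assms(3) by (rule closest_point_in_set)
  have "norm c \<le> 1"
    using max by (simp add: is_arg_max_def)
  have "norm p \<le> t_inf L (sgn p)"
    unfolding p_def using assms(2) \<open>closed L\<close> assms(3)
    by (rule norm_closest_point_le_t_inf_sgn)
  also have "\<dots> \<le> t_inf L c"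
    using max by (auto simp: is_arg_max_linorder norm_sgn)
  finally have "norm p \<le> t_inf L c" .
  moreover have "t_inf L c \<le> c \<bullet> p"
    using assms(1) \<open>p \<in> L\<close> by (rule t_inf_le)
  moreover have "c \<bullet> p \<le> norm p"
    using norm_cauchy_schwarz[of c p] mult_right_mono[OF \<open>norm c \<le> 1\<close> norm_ge_zero[of p]]
    by simp
  ultimately have "c \<bullet> p = norm p" "t_inf L c = norm p"
    by auto
  then show ?thesis
    using eq_norm_scaleR_if_inner_eq_norm[OF \<open>norm c \<le> 1\<close>] by (simp add: p_def)
qed

theorem lemma4p9:
  fixes z :: "nat \<Rightarrow> real ^ 'n"
    and m :: nat
    and L :: "(real ^ 'n) set"
    and c_hat :: "real ^ 'n"
  assumes "m \<ge> 1"
    and "L = convex hull (z ` {1..m})"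
    and "is_arg_max (t_inf L) (\<lambda>c. norm c \<le> 1) c_hat"
  shows "(\<forall>v. t_inf L c_hat > 0 \<and> v = t_inf L c_hat *\<^sub>R c_hat \<longrightarrow> closest_point L 0 = v) \<and>
         (t_inf L c_hat = 0 \<longrightarrow> closest_point L 0 = 0)"
proof -
  have "compact L" "convex L" "L \<noteq> {}"
    using assms(1,2) by (auto intro: finite_imp_compact_convex_hull)
  then have "closest_point L 0 = t_inf L c_hat *\<^sub>R c_hat"
    using assms(3) by (rule closest_point_eq_t_inf_scaleR_maximiser)
  then show ?thesis by simp
qed

end
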